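(* Let $X$ and $Y$ be linear spaces over a field $\mathbb{K}$, let $\alpha_{1},\alpha_{2},\gamma_{1,1},\gamma_{1,2},\gamma_{2,1},\gamma_{2,2}\in \mathbb{K}$ be given constants such that not all of them are zero, where $\alpha_{1},\alpha_{2}\neq 0$, and let $f\colon X\times Y\to \mathbb{K}$ be a function with $f(0,0)=0$ such that \[ f(\alpha_{1}x_{1}+\alpha_{2}x_{2},0)=\gamma_{1,1}f(x_{1},y_{1})+\gamma_{1,2}f(x_{1},y_{2})+\gamma_{2,1}f(x_{2},y_{1})+\gamma_{2,2}f(x_{2},y_{2}) \qquad (x_{1}, x_{2}\in X,\ y_{1}, y_{2}\in Y). \] Then and only then there exist an additive function $a\colon X\to \mathbb{K}$ and a function $\zeta\colon Y\to \mathbb{K}$ vanishing at zero such that \[ f(x,y)=a(x)+\zeta(y) \qquad (x\in X,\ y\in Y). \] Furthermore, the additive function $a$ has to fulfill \[ a(\alpha_{1}x_{1}+\alpha_{2}x_{2})=(\gamma_{1,1}+\gamma_{1,2})a(x_{1})+(\gamma_{2,1}+\gamma_{2,2})a(x_{2}) \] for arbitrary $x_{1},x_{2}\in X$, and for the mapping $\zeta$ the following alternative is fulfilled: either $\gamma_{1,1}+\gamma_{2,1}=0$ and $\gamma_{1,2}+\gamma_{2,2}=0$, or the function $\zeta$ is identically zero.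
   Context: A function $a\colon X\to\mathbb{K}$ is additive if $a(x+x')=a(x)+a(x')$ for all $x,x'\in X$. "Then and only then" means that the functional equation holds if and only if $f$ has the stated form together with the stated conditions on $a$ and $\zeta$.
   Formalization: "Not all of them are zero" is taken to mean that not all of the four constants γ_{i,j} are zero; if all γ_{i,j} vanish the claim fails, e.g. for X=Y=K and f(x,y)=xy. *)

theory Defs
  imports Complex_Main
begin

end

theory Submission
  imports Defs
begin

text \<open>
  Setting \<open>y\<^sub>1 = y\<^sub>2 = 0\<close> gives an equation for \<open>a x = f (x, 0)\<close> alone,
  \<open>a (\<alpha>\<^sub>1 x\<^sub>1 + \<alpha>\<^sub>2 x\<^sub>2) = A * a x\<^sub>1 + B * a x\<^sub>2\<close>, with
  \<open>A = \<gamma>\<^sub>1\<^sub>1 + \<gamma>\<^sub>1\<^sub>2\<close> and \<open>B = \<gamma>\<^sub>2\<^sub>1 + \<gamma>\<^sub>2\<^sub>2\<close>. Putting one argument to zero identifies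
  \<open>A * a x\<close> with \<open>a (\<alpha>\<^sub>1 x)\<close> and \<open>B * a x\<close> with \<open>a (\<alpha>\<^sub>2 x)\<close>, and since \<open>\<alpha>\<^sub>1\<close> and \<open>\<alpha>\<^sub>2\<close> are
  invertible, \<open>a\<close> is additive (lemma \<open>additive_if_linear_equation\<close>).

  Subtracting that equation from the original one removes the left-hand side, so the defect
  \<open>h (x, y) = f (x, y) - f (x, 0)\<close> satisfies a homogeneous equation. As \<open>h (x, 0) = 0\<close>, setting
  \<open>y\<^sub>2 = 0\<close> or \<open>y\<^sub>1 = 0\<close> splits it into
  \<open>\<gamma>\<^sub>1\<^sub>1 h (x\<^sub>1, y) + \<gamma>\<^sub>2\<^sub>1 h (x\<^sub>2, y) = 0\<close> and \<open>\<gamma>\<^sub>1\<^sub>2 h (x\<^sub>1, y) + \<gamma>\<^sub>2\<^sub>2 h (x\<^sub>2, y) = 0\<close>.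
  One coefficient is nonzero, and the relation it occurs in forces \<open>h\<close> not to depend on \<open>x\<close>
  (lemma \<open>constant_if_linear_relation\<close>); its value is \<open>\<zeta> y\<close>. Then both column sums of the
  \<open>\<gamma>\<close> annihilate \<open>\<zeta>\<close>, which is the stated alternative. The converse is a direct substitution.
\<close>

text \<open>
  The substitution \<open>x\<^sub>1 = u / \<alpha>\<close>, \<open>x\<^sub>2 = v / \<beta>\<close> turns the left-hand side into \<open>g (u + v)\<close>;
  since \<open>g 0 = 0\<close>, the same substitution with \<open>v = 0\<close> or \<open>u = 0\<close> shows that the two terms on
  the right are \<open>g u\<close> and \<open>g v\<close>.
\<close>

lemma additive_if_linear_equation:
  fixes scale :: "'k::field \<Rightarrow> 'x::ab_group_add \<Rightarrow> 'x"
    and g :: "'x \<Rightarrow> 'k"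
  assumes "vector_space scale"
    and "\<alpha> \<noteq> 0" and "\<beta> \<noteq> 0" and "g 0 = 0"
    and eq: "\<And>x1 x2. g (scale \<alpha> x1 + scale \<beta> x2) = A * g x1 + B * g x2"
  shows "Modules.additive g"
proof
  interpret vector_space scale by fact
  fix u v :: 'x
  define x1 where "x1 = scale (inverse \<alpha>) u"
  define x2 where "x2 = scale (inverse \<beta>) v"
  have u: "scale \<alpha> x1 = u" and v: "scale \<beta> x2 = v"
    using \<open>\<alpha> \<noteq> 0\<close> \<open>\<beta> \<noteq> 0\<close> by (simp_all add: x1_def x2_def)
  have "g u = A * g x1" and "g v = B * g x2"
    using eq[of x1 0] eq[of 0 x2] by (simp_all add: u v \<open>g 0 = 0\<close>)
  then show "g (u + v) = g u + g v"
    using eq[of x1 x2] by (simp add: u v)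
qed

text \<open>
  Letting one argument vary while the other stays fixed shows that \<open>c * u\<close> and \<open>d * u\<close> are
  constant, and one of the two coefficients can be cancelled.
\<close>

lemma constant_if_linear_relation:
  fixes u :: "'x \<Rightarrow> 'k::field"
  assumes rel: "\<And>x1 x2. c * u x1 + d * u x2 = 0"
    and "c \<noteq> 0 \<or> d \<noteq> 0"
  shows "u x = u x'"
proof -
  have "c * u x = c * u x'"
    using rel[of x x] rel[of x' x] by (metis add_right_cancel)
  moreover have "d * u x = d * u x'"
    using rel[of x x] rel[of x x'] by (metis add_left_cancel)
  ultimately show ?thesis
    using assms(2) by auto
qed

theorem proposition12:
  fixes scaleX :: "'k::field \<Rightarrow> 'x::ab_group_add \<Rightarrow> 'x"  (infixr \<open>*X\<close> 75)
    and scaleY :: "'k \<Rightarrow> 'y::ab_group_add \<Rightarrow> 'y"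
    and \<alpha>1 \<alpha>2 \<gamma>11 \<gamma>12 \<gamma>21 \<gamma>22 :: 'k
    and f :: "'x \<times> 'y \<Rightarrow> 'k"
  assumes "vector_space scaleX"
    and "vector_space scaleY"
    and "\<alpha>1 \<noteq> 0" and "\<alpha>2 \<noteq> 0"
    and "\<not> (\<gamma>11 = 0 \<and> \<gamma>12 = 0 \<and> \<gamma>21 = 0 \<and> \<gamma>22 = 0)"
    and "f (0, 0) = 0"
  shows "(\<forall>x1 x2 y1 y2. f (\<alpha>1 *X x1 + \<alpha>2 *X x2, 0) =
             \<gamma>11 * f (x1, y1) + \<gamma>12 * f (x1, y2) + \<gamma>21 * f (x2, y1) + \<gamma>22 * f (x2, y2))
     \<longleftrightarrow> (\<exists>(a :: 'x \<Rightarrow> 'k) (\<zeta> :: 'y \<Rightarrow> 'k).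
            Modules.additive a \<and> \<zeta> 0 = 0 \<and>
            (\<forall>x y. f (x, y) = a x + \<zeta> y) \<and>
            (\<forall>x1 x2. a (\<alpha>1 *X x1 + \<alpha>2 *X x2) = (\<gamma>11 + \<gamma>12) * a x1 + (\<gamma>21 + \<gamma>22) * a x2) \<and>
            ((\<gamma>11 + \<gamma>21 = 0 \<and> \<gamma>12 + \<gamma>22 = 0) \<or> (\<forall>y. \<zeta> y = 0)))"
proof (intro iffI)
  assume "\<forall>x1 x2 y1 y2. f (\<alpha>1 *X x1 + \<alpha>2 *X x2, 0) =
             \<gamma>11 * f (x1, y1) + \<gamma>12 * f (x1, y2) + \<gamma>21 * f (x2, y1) + \<gamma>22 * f (x2, y2)"
  then have eq: "f (\<alpha>1 *X x1 + \<alpha>2 *X x2, 0) =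
      \<gamma>11 * f (x1, y1) + \<gamma>12 * f (x1, y2) + \<gamma>21 * f (x2, y1) + \<gamma>22 * f (x2, y2)"
    for x1 x2 y1 y2 by blast
  define a where "a x = f (x, 0)" for x
  have a_eq: "a (\<alpha>1 *X x1 + \<alpha>2 *X x2) = (\<gamma>11 + \<gamma>12) * a x1 + (\<gamma>21 + \<gamma>22) * a x2" for x1 x2
    using eq[of x1 x2 0 0] by (simp add: a_def algebra_simps)
  have "a 0 = 0"
    using \<open>f (0, 0) = 0\<close> by (simp add: a_def)
  with a_eq have "Modules.additive a"
    using additive_if_linear_equation[OF \<open>vector_space scaleX\<close> \<open>\<alpha>1 \<noteq> 0\<close> \<open>\<alpha>2 \<noteq> 0\<close>] by blast

  define h where "h x y = f (x, y) - f (x, 0)" for x y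
  have rel1: "\<gamma>11 * h x1 y + \<gamma>21 * h x2 y = 0" for x1 x2 y
    using eq[of x1 x2 y 0] eq[of x1 x2 0 0] by (simp add: h_def algebra_simps)
  have rel2: "\<gamma>12 * h x1 y + \<gamma>22 * h x2 y = 0" for x1 x2 y
    using eq[of x1 x2 0 y] eq[of x1 x2 0 0] by (simp add: h_def algebra_simps)
  have h_const: "h x y = h 0 y" for x y
  proof (cases "\<gamma>11 \<noteq> 0 \<or> \<gamma>21 \<noteq> 0")
    case True
    then show ?thesis
      using constant_if_linear_relation[of \<gamma>11 "\<lambda>x. h x y" \<gamma>21] rel1 by blast
  next
    case False
    then have "\<gamma>12 \<noteq> 0 \<or> \<gamma>22 \<noteq> 0"
      using assms(5) by blast
    then show ?thesis
      using constant_if_linear_relation[of \<gamma>12 "\<lambda>x. h x y" \<gamma>22] rel2 by blast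
  qed
  have "f (x, y) = a x + h 0 y" for x y
    using h_const[of x y] by (simp add: a_def h_def algebra_simps)
  moreover have "(\<gamma>11 + \<gamma>21) * h 0 y = 0" and "(\<gamma>12 + \<gamma>22) * h 0 y = 0" for y
    using rel1[of 0 y 0] rel2[of 0 y 0] by (simp_all add: distrib_right)
  then have "(\<gamma>11 + \<gamma>21 = 0 \<and> \<gamma>12 + \<gamma>22 = 0) \<or> (\<forall>y. h 0 y = 0)"
    by auto
  moreover have "h 0 0 = 0"
    by (simp add: h_def)
  ultimately show "\<exists>(a :: 'x \<Rightarrow> 'k) (\<zeta> :: 'y \<Rightarrow> 'k).
            Modules.additive a \<and> \<zeta> 0 = 0 \<and>
            (\<forall>x y. f (x, y) = a x + \<zeta> y) \<and>
            (\<forall>x1 x2. a (\<alpha>1 *X x1 + \<alpha>2 *X x2) = (\<gamma>11 + \<gamma>12) * a x1 + (\<gamma>21 + \<gamma>22) * a x2) \<and>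
            ((\<gamma>11 + \<gamma>21 = 0 \<and> \<gamma>12 + \<gamma>22 = 0) \<or> (\<forall>y. \<zeta> y = 0))"
    using \<open>Modules.additive a\<close> a_eq by (intro exI[of _ a] exI[of _ "h 0"]) blast
next
  assume "\<exists>(a :: 'x \<Rightarrow> 'k) (\<zeta> :: 'y \<Rightarrow> 'k).
            Modules.additive a \<and> \<zeta> 0 = 0 \<and>
            (\<forall>x y. f (x, y) = a x + \<zeta> y) \<and>
            (\<forall>x1 x2. a (\<alpha>1 *X x1 + \<alpha>2 *X x2) = (\<gamma>11 + \<gamma>12) * a x1 + (\<gamma>21 + \<gamma>22) * a x2) \<and>
            ((\<gamma>11 + \<gamma>21 = 0 \<and> \<gamma>12 + \<gamma>22 = 0) \<or> (\<forall>y. \<zeta> y = 0))"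
  then obtain a :: "'x \<Rightarrow> 'k" and \<zeta> :: "'y \<Rightarrow> 'k"
    where "\<zeta> 0 = 0" and f: "\<And>x y. f (x, y) = a x + \<zeta> y"
      and a_eq: "\<And>x1 x2. a (\<alpha>1 *X x1 + \<alpha>2 *X x2) = (\<gamma>11 + \<gamma>12) * a x1 + (\<gamma>21 + \<gamma>22) * a x2"
      and alt: "(\<gamma>11 + \<gamma>21 = 0 \<and> \<gamma>12 + \<gamma>22 = 0) \<or> (\<forall>y. \<zeta> y = 0)"
    by blast
  show "\<forall>x1 x2 y1 y2. f (\<alpha>1 *X x1 + \<alpha>2 *X x2, 0) =
             \<gamma>11 * f (x1, y1) + \<gamma>12 * f (x1, y2) + \<gamma>21 * f (x2, y1) + \<gamma>22 * f (x2, y2)"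
  proof (intro allI)
    fix x1 x2 :: 'x and y1 y2 :: 'y
    have "\<gamma>11 * f (x1, y1) + \<gamma>12 * f (x1, y2) + \<gamma>21 * f (x2, y1) + \<gamma>22 * f (x2, y2) =
        (\<gamma>11 + \<gamma>12) * a x1 + (\<gamma>21 + \<gamma>22) * a x2 + ((\<gamma>11 + \<gamma>21) * \<zeta> y1 + (\<gamma>12 + \<gamma>22) * \<zeta> y2)"
      by (simp add: f algebra_simps)
    also have "(\<gamma>11 + \<gamma>21) * \<zeta> y1 + (\<gamma>12 + \<gamma>22) * \<zeta> y2 = 0"
      using alt by auto
    finally show "f (\<alpha>1 *X x1 + \<alpha>2 *X x2, 0) =
        \<gamma>11 * f (x1, y1) + \<gamma>12 * f (x1, y2) + \<gamma>21 * f (x2, y1) + \<gamma>22 * f (x2, y2)"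
      by (simp add: f a_eq \<open>\<zeta> 0 = 0\<close>)
  qed
qed

end
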